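(* Let $h\colon\mathcal{X}\to\mathcal{Y}$ be a classifier. For $s\colon\mathcal{X}\to\mathbb{R}$ let $$E_{\rm reg}(s)=\int_{\mathcal{X}}\sum_{y\in\mathcal{Y}}p(x,y)\,\big(\ell(y,h(x))-s(x)\big)^2\,dx .$$ Then the conditional risk $r(x)=\sum_{y\in\mathcal{Y}}p(y\mid x)\,\ell(y,h(x))$ is an optimal solution to $\min_{s\colon\mathcal{X}\to\mathbb{R}}E_{\rm reg}(s)$.
   Context: $\mathcal{X}$ is a set of inputs (a measurable space with a fixed reference measure $dx$), $\mathcal{Y}$ is a finite set of labels, $p(x,y)$ is a probability density on $\mathcal{X}\times\mathcal{Y}$ (with respect to $dx$ times counting measure), $p(x)=\sum_{y\in\mathcal{Y}}p(x,y)$ is its marginal, and $p(y\mid x)$ is the conditional distribution, so $p(x,y)=p(x)p(y\mid x)$. $\ell\colon\mathcal{Y}\times\mathcal{Y}\to[0,\infty)$ is a loss. All functions are taken measurable. ($E_{\rm reg}(s)$ equals the expectation of the empirical objective $\frac1n\sum_{i=1}^n(\ell(y_i,h(x_i))-s(x_i))^2$ over $n$ i.i.d. samples $(x_i,y_i)$ from $p(x,y)$.) *)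

theory Defs
  imports "HOL-Probability.Probability"
begin

definition joint_density :: "'x measure \<Rightarrow> 'y set \<Rightarrow> ('x \<Rightarrow> 'y \<Rightarrow> real) \<Rightarrow> bool" where
  "joint_density M Y p \<longleftrightarrow>
     (\<lambda>(x, y). p x y) \<in> borel_measurable (M \<Otimes>\<^sub>M count_space Y) \<and>
     (\<forall>x\<in>space M. \<forall>y\<in>Y. 0 \<le> p x y) \<and>
     prob_space (density (M \<Otimes>\<^sub>M count_space Y) (\<lambda>(x, y). ennreal (p x y)))"

definition marginal :: "'y set \<Rightarrow> ('x \<Rightarrow> 'y \<Rightarrow> real) \<Rightarrow> 'x \<Rightarrow> real" where
  "marginal Y p x = (\<Sum>y\<in>Y. p x y)"

text \<open>
  The value \<open>q x y\<close> stands for \<open>p(y | x)\<close>. Where the marginal vanishes, the factorization does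
  not determine \<open>q x\<close>, which may then be any probability distribution on \<open>Y\<close>.
\<close>

definition conditional_distribution ::
    "'x measure \<Rightarrow> 'y set \<Rightarrow> ('x \<Rightarrow> 'y \<Rightarrow> real) \<Rightarrow> ('x \<Rightarrow> 'y \<Rightarrow> real) \<Rightarrow> bool" where
  "conditional_distribution M Y p q \<longleftrightarrow>
     (\<forall>y\<in>Y. (\<lambda>x. q x y) \<in> borel_measurable M) \<and>
     (\<forall>x\<in>space M. (\<forall>y\<in>Y. 0 \<le> q x y) \<and> (\<Sum>y\<in>Y. q x y) = 1) \<and>
     (\<forall>x\<in>space M. \<forall>y\<in>Y. p x y = marginal Y p x * q x y)"

text \<open>
  The objective takes values in \<open>[0, \<infinity>]\<close>: it may be infinite for a measurable \<open>s\<close>, where the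
  real-valued Bochner integral would return \<open>0\<close>.
\<close>

definition E_reg ::
    "'x measure \<Rightarrow> 'y set \<Rightarrow> ('x \<Rightarrow> 'y \<Rightarrow> real) \<Rightarrow> ('y \<Rightarrow> 'y \<Rightarrow> real) \<Rightarrow> ('x \<Rightarrow> 'y) \<Rightarrow>
      ('x \<Rightarrow> real) \<Rightarrow> ennreal" where
  "E_reg M Y p loss h s = (\<integral>\<^sup>+x. ennreal (\<Sum>y\<in>Y. p x y * (loss y (h x) - s x)\<^sup>2) \<partial>M)"

definition conditional_risk ::
    "'y set \<Rightarrow> ('x \<Rightarrow> 'y \<Rightarrow> real) \<Rightarrow> ('y \<Rightarrow> 'y \<Rightarrow> real) \<Rightarrow> ('x \<Rightarrow> 'y) \<Rightarrow> 'x \<Rightarrow> real" where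
  "conditional_risk Y q loss h x = (\<Sum>y\<in>Y. q x y * loss y (h x))"

end

theory Submission
  imports Defs
begin

text \<open>The minimisation decouples over x. Since \<open>p x y = marginal Y p x * q x y\<close>,
  the integrand at x is the marginal times the \<open>q x\<close>-weighted mean square deviation of
  the loss from the single number \<open>s x\<close>. Such a deviation is least at the weighted
  mean, which is the conditional risk (\<open>weighted_mean_square_deviation\<close>). Integrating
  this pointwise bound gives \<open>E_reg_conditional_risk_le\<close>, also when the objective is
  infinite; \<open>borel_measurable_conditional_risk\<close> makes the minimiser admissible.\<close>

text \<open>Bias-variance decomposition: the cross term vanishes because deviations from the
  weighted mean have weighted sum 0.\<close>

lemma weighted_mean_square_deviation:
  fixes w f :: "'a \<Rightarrow> real"
  assumes "(\<Sum>y\<in>Y. w y) = 1"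
  shows "(\<Sum>y\<in>Y. w y * (f y - c)\<^sup>2) =
    (\<Sum>y\<in>Y. w y * (f y - (\<Sum>y\<in>Y. w y * f y))\<^sup>2) + ((\<Sum>y\<in>Y. w y * f y) - c)\<^sup>2"
proof -
  \<comment> \<open>Kept general in \<open>d\<close>, to be applied both at \<open>c\<close> and at
    the mean.\<close>
  have expand: "(\<Sum>y\<in>Y. w y * (f y - d)\<^sup>2) =
      (\<Sum>y\<in>Y. w y * (f y)\<^sup>2) - 2 * d * (\<Sum>y\<in>Y. w y * f y) + d\<^sup>2" for d
  proof -
    have "(\<Sum>y\<in>Y. w y * (f y - d)\<^sup>2) =
        (\<Sum>y\<in>Y. w y * (f y)\<^sup>2 - 2 * d * (w y * f y) + d\<^sup>2 * w y)"
      by (intro sum.cong refl) (simp add: power2_eq_square algebra_simps)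
    also have "\<dots> = (\<Sum>y\<in>Y. w y * (f y)\<^sup>2) - 2 * d * (\<Sum>y\<in>Y. w y * f y) + d\<^sup>2 * (\<Sum>y\<in>Y. w y)"
      by (simp only: sum.distrib sum_subtractf sum_distrib_left)
    finally show ?thesis
      using assms by simp
  qed
  show ?thesis
    unfolding expand by (simp add: power2_eq_square algebra_simps)
qed

lemma borel_measurable_conditional_risk:
  assumes "\<And>y. y \<in> Y \<Longrightarrow> (\<lambda>x. q x y) \<in> borel_measurable M"
    and "h \<in> M \<rightarrow>\<^sub>M count_space Y"
  shows "conditional_risk Y q loss h \<in> borel_measurable M"
proof -
  \<comment> \<open>Every function on the discrete space \<open>count_space Y\<close> is measurable,
    so composing with \<open>h\<close> suffices.\<close>
  have "(\<lambda>x. loss y (h x)) \<in> borel_measurable M" for y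
    using measurable_compose[OF assms(2), of "loss y" borel] by simp
  then show ?thesis
    unfolding conditional_risk_def using assms(1)
    by (intro borel_measurable_sum borel_measurable_times)
qed

lemma E_reg_conditional_risk_le:
  assumes nonneg: "\<And>x y. x \<in> space M \<Longrightarrow> y \<in> Y \<Longrightarrow> 0 \<le> p x y"
    and q: "conditional_distribution M Y p q"
  shows "E_reg M Y p loss h (conditional_risk Y q loss h) \<le> E_reg M Y p loss h s"
  unfolding E_reg_def
proof (intro nn_integral_mono ennreal_leI)
  fix x assume x: "x \<in> space M"
  have factor: "(\<Sum>y\<in>Y. p x y * (loss y (h x) - c)\<^sup>2) =
      marginal Y p x * (\<Sum>y\<in>Y. q x y * (loss y (h x) - c)\<^sup>2)" for c
    unfolding sum_distrib_left mult.assoc[symmetric]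
    using q x by (intro sum.cong refl) (metis conditional_distribution_def)
  have "(\<Sum>y\<in>Y. q x y) = 1"
    using q x by (simp add: conditional_distribution_def)
  \<comment> \<open>The excess of the right side over the left is the square of the conditional risk
    minus \<open>s x\<close>.\<close>
  from weighted_mean_square_deviation[OF this, of "\<lambda>y. loss y (h x)" "s x"]
  have "(\<Sum>y\<in>Y. q x y * (loss y (h x) - conditional_risk Y q loss h x)\<^sup>2) \<le>
      (\<Sum>y\<in>Y. q x y * (loss y (h x) - s x)\<^sup>2)"
    by (simp add: conditional_risk_def)
  moreover have "0 \<le> marginal Y p x"
    unfolding marginal_def using nonneg x by (intro sum_nonneg)
  ultimately show "(\<Sum>y\<in>Y. p x y * (loss y (h x) - conditional_risk Y q loss h x)\<^sup>2) \<le>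
      (\<Sum>y\<in>Y. p x y * (loss y (h x) - s x)\<^sup>2)"
    unfolding factor by (rule mult_left_mono)
qed

theorem theorem7:
  fixes M :: "'x measure" and Y :: "'y set"
    and p q :: "'x \<Rightarrow> 'y \<Rightarrow> real"
    and loss :: "'y \<Rightarrow> 'y \<Rightarrow> real"
    and h :: "'x \<Rightarrow> 'y"
  assumes "finite Y"
    and "joint_density M Y p"
    and "conditional_distribution M Y p q"
    and "\<And>y y'. y \<in> Y \<Longrightarrow> y' \<in> Y \<Longrightarrow> 0 \<le> loss y y'"
    and "h \<in> M \<rightarrow>\<^sub>M count_space Y"
  shows "is_arg_min (E_reg M Y p loss h) (\<lambda>s. s \<in> borel_measurable M) (conditional_risk Y q loss h)"
proof -
  have "conditional_risk Y q loss h \<in> borel_measurable M"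
    using assms(3,5)
    by (intro borel_measurable_conditional_risk) (simp_all add: conditional_distribution_def)
  moreover have "E_reg M Y p loss h (conditional_risk Y q loss h) \<le> E_reg M Y p loss h s" for s
    using assms(2,3) by (intro E_reg_conditional_risk_le) (simp_all add: joint_density_def)
  \<comment> \<open>\<open>is_arg_min\<close> only forbids strictly smaller values; as
    \<open>ennreal\<close> is linearly ordered, this amounts to a lower bound.\<close>
  ultimately show ?thesis
    by (simp add: is_arg_min_linorder)
qed

end
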